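(* Let $X$ be a $K3$ surface equipped with a polarization $\mathcal{O}_X(1)$, and let $TX$ be its tangent bundle. Let $V$ be a non-split extension $$0\rightarrow TX\rightarrow V\rightarrow \mathcal{O}_X\rightarrow 0,$$ and equip the rank $6$ vector bundle $V\oplus V^{\vee}$ with the orthogonal structure (symmetric nondegenerate form) $\varphi:(V\oplus V^{\vee})\otimes(V\oplus V^{\vee})\to\mathcal{O}_X$, $\varphi((v,f),(w,g))=f(w)+g(v)$, given by the duality pairing. Let $E$ be the corresponding principal $\mathrm{O}(6,\mathbb{C})$-bundle over $X$. Then the Gieseker Harder-Narasimhan filtration $$0\subset \mathcal{O}_X\subset V\oplus\mathcal{O}_X\subset V\oplus V^{\vee}$$ of $V\oplus V^{\vee}$ (where $\mathcal{O}_X\subset V^{\vee}$ is the dual of the surjection $V\to\mathcal{O}_X$) does not correspond to any parabolic reduction of the principal $\mathrm{O}(6,\mathbb{C})$-bundle $E$.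
   Context: A $K3$ surface is a smooth complex projective surface $X$ with $h^1(\mathcal{O}_X)=0$ and trivial canonical bundle. A polarization is an ample line bundle $\mathcal{O}_X(1)$ on $X$. The Hilbert polynomial of a torsion free coherent sheaf $F$ on $X$ is $P_F(m)=\chi(F\otimes\mathcal{O}_X(m))$. Polynomials in $m$ are compared by their values for $m\gg 0$. A torsion free coherent sheaf $F$ is Gieseker semistable if for every nonzero subsheaf $F'\subset F$ with $\operatorname{rk}F'<\operatorname{rk}F$ one has $\frac{P_{F'}(m)}{\operatorname{rk}F'}\leq\frac{P_F(m)}{\operatorname{rk}F}$ for $m\gg 0$. The Gieseker Harder-Narasimhan filtration of a torsion free sheaf $F$ is the unique filtration $0\subset F_1\subset\cdots\subset F_{t+1}=F$ whose successive quotients $F^i=F_i/F_{i-1}$ (with $F_0=0$) are torsion free and Gieseker semistable and satisfy $\frac{P_{F^1}(m)}{\operatorname{rk}F^1}>\cdots>\frac{P_{F^{t+1}}(m)}{\operatorname{rk}F^{t+1}}$ for $m\gg0$. For $V\oplus V^\vee$ as in the claim, this filtration is the one displayed there. Filtration corresponding to a parabolic reduction. Let $G=\mathrm{O}(6,\mathbb{C})$ with its standard representation on $\mathbb{C}^6$, and let $E$ be a principal $G$-bundle on $X$ with associated vector bundle $E(\mathbb{C}^6)$ (here $E(\mathbb{C}^6)=V\oplus V^{\vee}$). A one parameter subgroup $\lambda:\mathbb{C}^*\to G$ defines the parabolic subgroup $P(\lambda)=\{g\in G\mid \lim_{t\to\infty}\lambda(t)g\lambda(t)^{-1}\text{ exists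 in }G\}$; all parabolic subgroups are taken to be of this form. Let $\gamma_1<\cdots<\gamma_l$ be the distinct weights of $\lambda$ on $\mathbb{C}^6$, let $W^i$ be the subspace on which $\lambda(t)$ acts as $t^{\gamma_i}$, and set $W_i=\bigoplus_{j=1}^i W^j$. The filtration $0\subset W_1\subset\cdots\subset W_l=\mathbb{C}^6$ is preserved by $P(\lambda)$. An open subset $\iota:U\hookrightarrow X$ is big if its complement has codimension at least $2$. A reduction of structure group of $E$ to $P(\lambda)$ over a big open set $U$ produces, by associating the $P(\lambda)$-subrepresentations $W_i$, a filtration of $E(\mathbb{C}^6)|_U$ by subbundles $F_1^U\subset\cdots\subset F_l^U=E(\mathbb{C}^6)|_U$, and hence a filtration $0\subset F_1\subset\cdots\subset F_l=E(\mathbb{C}^6)$ by the torsion free sheaves $F_i=\iota_*F_i^U\cap E(\mathbb{C}^6)$. A filtration of $E(\mathbb{C}^6)$ corresponds to a parabolic reduction of $E$ if it equals the filtration $F_\bullet$ obtained in this way from some $\lambda$, some big open set $U$ and some reduction of structure group of $E$ to $P(\lambda)$ over $U$. *)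

theory Defs
  imports "HOL-Analysis.Analysis" "HOL-Algebra.Module"
begin

section \<open>Spaces with functions\<close>

text \<open>
  Varieties are classical complex varieties: sets of closed points with the Zariski topology and
  a sheaf of complex-valued regular functions.  A function on \<open>U\<close> is represented by its
  extensional representative (value \<open>undefined\<close> outside \<open>U\<close>); all functions and operations below
  are only meaningful on open sets.
\<close>

record 'a fspace =
  topo :: "'a topology"
  reg :: "'a set \<Rightarrow> ('a \<Rightarrow> complex) set"

definition Opens :: "'a fspace \<Rightarrow> 'a set set" where
  "Opens X = {U. openin (topo X) U}"

definition points :: "'a fspace \<Rightarrow> 'a set" where
  "points X = topspace (topo X)"

definition restr :: "'a fspace \<Rightarrow> 'a set \<Rightarrow> 'a fspace" where
  "restr X U = \<lparr>topo = subtopology (topo X) U, reg = reg X\<rparr>"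

definition reg_ring :: "'a fspace \<Rightarrow> 'a set \<Rightarrow> ('a \<Rightarrow> complex) ring" where
  "reg_ring X U = \<lparr>carrier = reg X U,
     monoid.mult = (\<lambda>f g. \<lambda>x\<in>U. f x * g x), one = (\<lambda>x\<in>U. 1),
     ring.zero = (\<lambda>x\<in>U. 0), add = (\<lambda>f g. \<lambda>x\<in>U. f x + g x)\<rparr>"

definition fs_morphism :: "'a fspace \<Rightarrow> 'b fspace \<Rightarrow> ('a \<Rightarrow> 'b) \<Rightarrow> bool" where
  "fs_morphism X Y h \<longleftrightarrow> continuous_map (topo X) (topo Y) h \<and>
     (\<forall>S\<in>Opens Y. \<forall>f\<in>reg Y S.
        (\<lambda>x\<in>{x \<in> points X. h x \<in> S}. f (h x)) \<in> reg X {x \<in> points X. h x \<in> S})"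

definition irreducible_set :: "'a topology \<Rightarrow> 'a set \<Rightarrow> bool" where
  "irreducible_set T S \<longleftrightarrow> S \<subseteq> topspace T \<and> S \<noteq> {} \<and>
     (\<forall>A B. closedin T A \<and> closedin T B \<and> S \<subseteq> A \<union> B \<longrightarrow> S \<subseteq> A \<or> S \<subseteq> B)"

definition irr_chain :: "'a topology \<Rightarrow> 'a set list \<Rightarrow> bool" where
  "irr_chain T Zs \<longleftrightarrow> sorted_wrt (\<subset>) Zs \<and> (\<forall>Z\<in>set Zs. closedin T Z \<and> irreducible_set T Z)"

definition has_dimension :: "'a fspace \<Rightarrow> nat \<Rightarrow> bool" where
  "has_dimension X n \<longleftrightarrow> (\<exists>Zs. irr_chain (topo X) Zs \<and> length Zs = n + 1) \<and>
     (\<forall>Zs. irr_chain (topo X) Zs \<longrightarrow> length Zs \<le> n + 1)"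

text \<open>
  Open sets whose complement has codimension at least 2: every irreducible closed subset of the
  complement is the bottom of a chain of length 2 of irreducible closed subsets of \<open>X\<close>.
\<close>

definition big_open :: "'a fspace \<Rightarrow> 'a set \<Rightarrow> bool" where
  "big_open X U \<longleftrightarrow> U \<in> Opens X \<and>
     (\<forall>Z. closedin (topo X) Z \<and> irreducible_set (topo X) Z \<and> Z \<subseteq> points X - U \<longrightarrow>
        (\<exists>Z1 Z2. irr_chain (topo X) [Z, Z1, Z2]))"

text \<open>
  All local rings are regular of dimension \<open>d\<close>: at each point \<open>x\<close> of a \<open>d\<close>-dimensional irreducible
  variety the maximal ideal of the local ring is generated by \<open>d\<close> elements (germs \<open>us\<close> on \<open>W\<close>).
\<close>

definition nonsingular :: "'a fspace \<Rightarrow> nat \<Rightarrow> bool" where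
  "nonsingular X d \<longleftrightarrow> (\<forall>x\<in>points X. \<exists>W\<in>Opens X. \<exists>us :: nat \<Rightarrow> 'a \<Rightarrow> complex.
     x \<in> W \<and> (\<forall>i<d. us i \<in> reg X W \<and> us i x = 0) \<and>
     (\<forall>W'\<in>Opens X. \<forall>f\<in>reg X W'. x \<in> W' \<and> f x = 0 \<longrightarrow>
        (\<exists>W''\<in>Opens X. \<exists>a :: nat \<Rightarrow> 'a \<Rightarrow> complex. x \<in> W'' \<and> W'' \<subseteq> W \<inter> W' \<and>
           (\<forall>i<d. a i \<in> reg X W'') \<and> (\<forall>y\<in>W''. f y = (\<Sum>i<d. a i y * us i y)))))"

section \<open>Projective varieties\<close>

text \<open>
  The points of the projective space of \<open>complex ^ 'n\<close> are its lines, as subsets of \<open>complex ^ 'n\<close>.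
  Complex polynomials are identified with polynomial functions.
\<close>

type_synonym 'n pspace = "(complex ^ 'n) set"

definition pt :: "complex ^ 'n \<Rightarrow> ('n::finite) pspace" where
  "pt v = range (\<lambda>c. c *s v)"

definition homog_poly :: "nat \<Rightarrow> (complex ^ ('n::finite) \<Rightarrow> complex) set" where
  "homog_poly d = {p. \<exists>c :: ('n \<Rightarrow> nat) \<Rightarrow> complex.
     p = (\<lambda>v. \<Sum>m | (\<Sum>i\<in>UNIV. m i) = d. c m * (\<Prod>i\<in>UNIV. (v $ i) ^ m i))}"

definition zariski :: "('n::finite) pspace topology" where
  "zariski = topology_generated_by
     {{pt v | v. v \<noteq> 0 \<and> p v \<noteq> 0} | p d. p \<in> homog_poly d}"

definition proj_variety :: "('n::finite) pspace set \<Rightarrow> 'n pspace fspace" where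
  "proj_variety Z = \<lparr>topo = subtopology zariski Z,
     reg = (\<lambda>U. {f \<in> extensional U. \<forall>x\<in>U. \<exists>W d p q.
        openin (subtopology zariski Z) W \<and> x \<in> W \<and> W \<subseteq> U \<and> p \<in> homog_poly d \<and> q \<in> homog_poly d \<and>
        (\<forall>v. v \<noteq> 0 \<and> pt v \<in> W \<longrightarrow> q v \<noteq> 0 \<and> f (pt v) = p v / q v)})\<rparr>"

text \<open>
  An open set is affine if it is the maximal spectrum of its (finitely generated) ring of regular
  functions, as a space with functions.
\<close>

definition affine_open :: "'a fspace \<Rightarrow> 'a set \<Rightarrow> bool" where
  "affine_open X U \<longleftrightarrow> U \<in> Opens X \<and>
     (\<exists>S. finite S \<and> S \<subseteq> reg X U \<and>
        (\<forall>A. S \<subseteq> A \<and> A \<subseteq> reg X U \<and> (\<forall>c. (\<lambda>x\<in>U. c) \<in> A) \<and>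
           (\<forall>f\<in>A. \<forall>g\<in>A. (\<lambda>x\<in>U. f x + g x) \<in> A \<and> (\<lambda>x\<in>U. f x * g x) \<in> A) \<longrightarrow> A = reg X U)) \<and>
     (\<forall>ev :: ('a \<Rightarrow> complex) \<Rightarrow> complex.
        (\<forall>c. ev (\<lambda>x\<in>U. c) = c) \<and>
        (\<forall>f\<in>reg X U. \<forall>g\<in>reg X U. ev (\<lambda>x\<in>U. f x + g x) = ev f + ev g \<and>
                                  ev (\<lambda>x\<in>U. f x * g x) = ev f * ev g) \<longrightarrow>
        (\<exists>!x. x \<in> U \<and> (\<forall>f\<in>reg X U. ev f = f x))) \<and>
     (\<forall>W\<in>Opens X. W \<subseteq> U \<longrightarrow> (\<forall>x\<in>W. \<exists>f\<in>reg X U. f x \<noteq> 0 \<and> {y \<in> U. f y \<noteq> 0} \<subseteq> W)) \<and>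
     (\<forall>W\<in>Opens X. W \<subseteq> U \<longrightarrow> (\<forall>g\<in>reg X W. \<forall>x\<in>W. \<exists>a\<in>reg X U. \<exists>b\<in>reg X U.
        b x \<noteq> 0 \<and> (\<forall>y\<in>W. b y \<noteq> 0 \<longrightarrow> g y = a y / b y)))"

section \<open>Sheaves of modules\<close>

text \<open>
  \<open>res F U W\<close> is the restriction map from \<open>U\<close> to \<open>W\<close>.  The ring fields \<open>mult\<close> and \<open>one\<close> of the
  module records carry no meaning.
\<close>

record ('a, 'm) presheaf =
  sec :: "'a set \<Rightarrow> ('a \<Rightarrow> complex, 'm) module"
  res :: "'a set \<Rightarrow> 'a set \<Rightarrow> 'm \<Rightarrow> 'm"

abbreviation sects :: "('a, 'm) presheaf \<Rightarrow> 'a set \<Rightarrow> 'm set" where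
  "sects F U \<equiv> carrier (sec F U)"

definition mk_module :: "'m set \<Rightarrow> 'm \<Rightarrow> ('m \<Rightarrow> 'm \<Rightarrow> 'm) \<Rightarrow> ('r \<Rightarrow> 'm \<Rightarrow> 'm) \<Rightarrow> ('r, 'm) module" where
  "mk_module C z a s = \<lparr>carrier = C, monoid.mult = a, one = z, ring.zero = z, add = a, smult = s\<rparr>"

definition sheaf_of_modules :: "'a fspace \<Rightarrow> ('a, 'm) presheaf \<Rightarrow> bool" where
  "sheaf_of_modules X F \<longleftrightarrow>
     (\<forall>U\<in>Opens X. Module.module (reg_ring X U) (sec F U)) \<and>
     (\<forall>U\<in>Opens X. \<forall>W\<in>Opens X. W \<subseteq> U \<longrightarrow>
        (\<forall>s\<in>sects F U. res F U W s \<in> sects F W) \<and>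
        (\<forall>s\<in>sects F U. \<forall>t\<in>sects F U.
           res F U W (s \<oplus>\<^bsub>sec F U\<^esub> t) = res F U W s \<oplus>\<^bsub>sec F W\<^esub> res F U W t) \<and>
        (\<forall>f\<in>reg X U. \<forall>s\<in>sects F U.
           res F U W (f \<odot>\<^bsub>sec F U\<^esub> s) = restrict f W \<odot>\<^bsub>sec F W\<^esub> res F U W s)) \<and>
     (\<forall>U\<in>Opens X. \<forall>s\<in>sects F U. res F U U s = s) \<and>
     (\<forall>U\<in>Opens X. \<forall>W\<in>Opens X. \<forall>W'\<in>Opens X. W' \<subseteq> W \<and> W \<subseteq> U \<longrightarrow>
        (\<forall>s\<in>sects F U. res F W W' (res F U W s) = res F U W' s)) \<and>
     (\<forall>\<U> s. \<U> \<subseteq> Opens X \<and> (\<forall>W\<in>\<U>. s W \<in> sects F W) \<and>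
        (\<forall>W\<in>\<U>. \<forall>W'\<in>\<U>. res F W (W \<inter> W') (s W) = res F W' (W \<inter> W') (s W')) \<longrightarrow>
        (\<exists>!t. t \<in> sects F (\<Union>\<U>) \<and> (\<forall>W\<in>\<U>. res F (\<Union>\<U>) W t = s W)))"

definition OX :: "'a fspace \<Rightarrow> ('a, 'a \<Rightarrow> complex) presheaf" where
  "OX X = \<lparr>sec = (\<lambda>U. mk_module (reg X U) (\<lambda>x\<in>U. 0) (\<lambda>f g. \<lambda>x\<in>U. f x + g x)
             (\<lambda>f g. \<lambda>x\<in>U. f x * g x)),
           res = (\<lambda>U W f. restrict f W)\<rparr>"

definition sheaf_hom ::
  "'a fspace \<Rightarrow> ('a, 'm) presheaf \<Rightarrow> ('a, 'k) presheaf \<Rightarrow> ('a set \<Rightarrow> 'm \<Rightarrow> 'k) \<Rightarrow> bool" where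
  "sheaf_hom X F G h \<longleftrightarrow>
     (\<forall>U\<in>Opens X.
        (\<forall>s\<in>sects F U. h U s \<in> sects G U) \<and>
        (\<forall>s\<in>sects F U. \<forall>t\<in>sects F U. h U (s \<oplus>\<^bsub>sec F U\<^esub> t) = h U s \<oplus>\<^bsub>sec G U\<^esub> h U t) \<and>
        (\<forall>f\<in>reg X U. \<forall>s\<in>sects F U. h U (f \<odot>\<^bsub>sec F U\<^esub> s) = f \<odot>\<^bsub>sec G U\<^esub> h U s) \<and>
        (\<forall>W\<in>Opens X. W \<subseteq> U \<longrightarrow> (\<forall>s\<in>sects F U. h W (res F U W s) = res G U W (h U s))))"

definition sheaf_iso :: "'a fspace \<Rightarrow> ('a, 'm) presheaf \<Rightarrow> ('a, 'k) presheaf \<Rightarrow> bool" where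
  "sheaf_iso X F G \<longleftrightarrow>
     (\<exists>h. sheaf_hom X F G h \<and> (\<forall>U\<in>Opens X. bij_betw (h U) (sects F U) (sects G U)))"

text \<open>
  Since \<open>\<alpha>\<close> is injective, its presheaf image is a sheaf, so exactness in the middle may be tested
  on sections over every open set; surjectivity of \<open>\<beta>\<close> is local.
\<close>

definition short_exact :: "'a fspace \<Rightarrow> ('a, 'm) presheaf \<Rightarrow> ('a, 'k) presheaf \<Rightarrow> ('a, 'l) presheaf \<Rightarrow>
    ('a set \<Rightarrow> 'm \<Rightarrow> 'k) \<Rightarrow> ('a set \<Rightarrow> 'k \<Rightarrow> 'l) \<Rightarrow> bool" where
  "short_exact X A B C \<alpha> \<beta> \<longleftrightarrow> sheaf_hom X A B \<alpha> \<and> sheaf_hom X B C \<beta> \<and>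
     (\<forall>U\<in>Opens X. inj_on (\<alpha> U) (sects A U) \<and>
        {s \<in> sects B U. \<beta> U s = \<zero>\<^bsub>sec C U\<^esub>} = \<alpha> U ` sects A U) \<and>
     (\<forall>U\<in>Opens X. \<forall>t\<in>sects C U. \<forall>x\<in>U.
        \<exists>W\<in>Opens X. x \<in> W \<and> W \<subseteq> U \<and> (\<exists>s\<in>sects B W. \<beta> W s = res C U W t))"

definition split_surj ::
  "'a fspace \<Rightarrow> ('a, 'k) presheaf \<Rightarrow> ('a, 'l) presheaf \<Rightarrow> ('a set \<Rightarrow> 'k \<Rightarrow> 'l) \<Rightarrow> bool" where
  "split_surj X B C \<beta> \<longleftrightarrow>
     (\<exists>\<sigma>. sheaf_hom X C B \<sigma> \<and> (\<forall>U\<in>Opens X. \<forall>t\<in>sects C U. \<beta> U (\<sigma> U t) = t))"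

text \<open>A section of the sheaf Hom over \<open>U\<close> is a homomorphism between the restrictions to \<open>U\<close>.\<close>

definition hom_sheaf :: "'a fspace \<Rightarrow> ('a, 'm) presheaf \<Rightarrow> ('a, 'k) presheaf \<Rightarrow>
    ('a, 'a set \<Rightarrow> 'm \<Rightarrow> 'k) presheaf" where
  "hom_sheaf X F G = \<lparr>
     sec = (\<lambda>U. mk_module
        {h \<in> (\<Pi>\<^sub>E W\<in>Opens (restr X U). extensional (sects F W)). sheaf_hom (restr X U) F G h}
        (\<lambda>W\<in>Opens (restr X U). \<lambda>s\<in>sects F W. \<zero>\<^bsub>sec G W\<^esub>)
        (\<lambda>h k. \<lambda>W\<in>Opens (restr X U). \<lambda>s\<in>sects F W. h W s \<oplus>\<^bsub>sec G W\<^esub> k W s)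
        (\<lambda>f h. \<lambda>W\<in>Opens (restr X U). \<lambda>s\<in>sects F W. restrict f W \<odot>\<^bsub>sec G W\<^esub> h W s)),
     res = (\<lambda>U U' h. restrict h (Opens (restr X U')))\<rparr>"

definition dual :: "'a fspace \<Rightarrow> ('a, 'm) presheaf \<Rightarrow> ('a, 'a set \<Rightarrow> 'm \<Rightarrow> 'a \<Rightarrow> complex) presheaf" where
  "dual X F = hom_sheaf X F (OX X)"

definition sum_sheaf :: "('a, 'm) presheaf \<Rightarrow> ('a, 'k) presheaf \<Rightarrow> ('a, 'm \<times> 'k) presheaf" where
  "sum_sheaf F G = \<lparr>
     sec = (\<lambda>U. mk_module (sects F U \<times> sects G U) (\<zero>\<^bsub>sec F U\<^esub>, \<zero>\<^bsub>sec G U\<^esub>)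
        (\<lambda>(s, t) (s', t'). (s \<oplus>\<^bsub>sec F U\<^esub> s', t \<oplus>\<^bsub>sec G U\<^esub> t'))
        (\<lambda>f (s, t). (f \<odot>\<^bsub>sec F U\<^esub> s, f \<odot>\<^bsub>sec G U\<^esub> t))),
     res = (\<lambda>U W (s, t). (res F U W s, res G U W t))\<rparr>"

definition subpresheaf :: "('a, 'm) presheaf \<Rightarrow> ('a set \<Rightarrow> 'm set) \<Rightarrow> ('a, 'm) presheaf" where
  "subpresheaf F S = \<lparr>sec = (\<lambda>U. (sec F U)\<lparr>carrier := S U\<rparr>), res = res F\<rparr>"

definition zero_sub :: "('a, 'm) presheaf \<Rightarrow> 'a set \<Rightarrow> 'm set" where
  "zero_sub F U = {\<zero>\<^bsub>sec F U\<^esub>}"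

definition nonzero_sheaf :: "'a fspace \<Rightarrow> ('a, 'm) presheaf \<Rightarrow> bool" where
  "nonzero_sheaf X F \<longleftrightarrow> (\<exists>U\<in>Opens X. sects F U \<noteq> {\<zero>\<^bsub>sec F U\<^esub>})"

text \<open>
  The quotient \<open>F/S\<close>: \<open>quot_germ X F S x W s\<close> is the class of the section \<open>s\<close> of \<open>F\<close> over \<open>W\<close> in
  the stalk of \<open>F/S\<close> at \<open>x\<close>; sections of the quotient are the families of such classes that are
  locally induced by sections of \<open>F\<close>.  The unions below are unions over representatives, all of
  which give the same class.
\<close>

definition quot_germ :: "'a fspace \<Rightarrow> ('a, 'm) presheaf \<Rightarrow> ('a set \<Rightarrow> 'm set) \<Rightarrow> 'a \<Rightarrow> 'a set \<Rightarrow> 'm \<Rightarrow>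
    ('a set \<times> 'm) set" where
  "quot_germ X F S x W s = {(W', s'). W' \<in> Opens X \<and> x \<in> W' \<and> s' \<in> sects F W' \<and>
     (\<exists>W''\<in>Opens X. x \<in> W'' \<and> W'' \<subseteq> W \<inter> W' \<and>
        res F W W'' s \<ominus>\<^bsub>sec F W''\<^esub> res F W' W'' s' \<in> S W'')}"

definition quot_sheaf :: "'a fspace \<Rightarrow> ('a, 'm) presheaf \<Rightarrow> ('a set \<Rightarrow> 'm set) \<Rightarrow>
    ('a, 'a \<Rightarrow> ('a set \<times> 'm) set) presheaf" where
  "quot_sheaf X F S = \<lparr>
     sec = (\<lambda>U. mk_module
        {\<sigma> \<in> extensional U. \<forall>x\<in>U. \<exists>W\<in>Opens X. \<exists>s\<in>sects F W.
           x \<in> W \<and> W \<subseteq> U \<and> (\<forall>y\<in>W. \<sigma> y = quot_germ X F S y W s)}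
        (\<lambda>x\<in>U. quot_germ X F S x U \<zero>\<^bsub>sec F U\<^esub>)
        (\<lambda>\<sigma> \<tau>. \<lambda>x\<in>U. \<Union>{quot_germ X F S x W (s \<oplus>\<^bsub>sec F W\<^esub> t) | W s t.
           W \<in> Opens X \<and> x \<in> W \<and> s \<in> sects F W \<and> t \<in> sects F W \<and>
           \<sigma> x = quot_germ X F S x W s \<and> \<tau> x = quot_germ X F S x W t})
        (\<lambda>f \<sigma>. \<lambda>x\<in>U. \<Union>{quot_germ X F S x W (restrict f W \<odot>\<^bsub>sec F W\<^esub> s) | W s.
           W \<in> Opens X \<and> x \<in> W \<and> W \<subseteq> U \<and> s \<in> sects F W \<and> \<sigma> x = quot_germ X F S x W s})),
     res = (\<lambda>U W \<sigma>. restrict \<sigma> W)\<rparr>"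

definition lincomb :: "('a, 'm) presheaf \<Rightarrow> 'a set \<Rightarrow> nat \<Rightarrow> (nat \<Rightarrow> 'a \<Rightarrow> complex) \<Rightarrow> (nat \<Rightarrow> 'm) \<Rightarrow> 'm" where
  "lincomb F U r f s = finsum (sec F U) (\<lambda>i. f i \<odot>\<^bsub>sec F U\<^esub> s i) {..<r}"

definition local_frame :: "'a fspace \<Rightarrow> ('a, 'm) presheaf \<Rightarrow> 'a set \<Rightarrow> nat \<Rightarrow> (nat \<Rightarrow> 'm) \<Rightarrow> bool" where
  "local_frame X F W r s \<longleftrightarrow> (\<forall>i<r. s i \<in> sects F W) \<and>
     (\<forall>W'\<in>Opens X. W' \<subseteq> W \<longrightarrow> (\<forall>t\<in>sects F W'.
        \<exists>!f. f \<in> {..<r} \<rightarrow>\<^sub>E reg X W' \<and> t = lincomb F W' r f (\<lambda>i. res F W W' (s i))))"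

definition locally_free :: "'a fspace \<Rightarrow> ('a, 'm) presheaf \<Rightarrow> nat \<Rightarrow> bool" where
  "locally_free X F r \<longleftrightarrow> sheaf_of_modules X F \<and>
     (\<forall>x\<in>points X. \<exists>W\<in>Opens X. x \<in> W \<and> (\<exists>s. local_frame X F W r s))"

text \<open>The rank at the generic point of an irreducible variety; coherent sheaves are generically free.\<close>

definition sheaf_rank :: "'a fspace \<Rightarrow> ('a, 'm) presheaf \<Rightarrow> nat" where
  "sheaf_rank X F = (THE r. \<exists>W\<in>Opens X. W \<noteq> {} \<and> (\<exists>s. local_frame X F W r s))"

definition finite_type :: "'a fspace \<Rightarrow> ('a, 'm) presheaf \<Rightarrow> bool" where
  "finite_type X F \<longleftrightarrow> (\<forall>x\<in>points X. \<exists>W\<in>Opens X. \<exists>r s. x \<in> W \<and> (\<forall>i<r. s i \<in> sects F W) \<and>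
     (\<forall>W'\<in>Opens X. W' \<subseteq> W \<longrightarrow> (\<forall>t\<in>sects F W'. \<forall>y\<in>W'.
        \<exists>W''\<in>Opens X. \<exists>f\<in>{..<r} \<rightarrow>\<^sub>E reg X W''. y \<in> W'' \<and> W'' \<subseteq> W' \<and>
           res F W' W'' t = lincomb F W'' r f (\<lambda>i. res F W W'' (s i)))))"

text \<open>The sheaf of relations between sections \<open>s 0, \<dots>, s (r - 1)\<close> of \<open>F\<close> over \<open>U0\<close>.\<close>

definition relation_sheaf :: "'a fspace \<Rightarrow> ('a, 'm) presheaf \<Rightarrow> 'a set \<Rightarrow> nat \<Rightarrow> (nat \<Rightarrow> 'm) \<Rightarrow>
    ('a, nat \<Rightarrow> 'a \<Rightarrow> complex) presheaf" where
  "relation_sheaf X F U0 r s = \<lparr>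
     sec = (\<lambda>U. mk_module
        {f \<in> {..<r} \<rightarrow>\<^sub>E reg X U. lincomb F U r f (\<lambda>i. res F U0 U (s i)) = \<zero>\<^bsub>sec F U\<^esub>}
        (\<lambda>i\<in>{..<r}. \<lambda>x\<in>U. 0)
        (\<lambda>f g. \<lambda>i\<in>{..<r}. \<lambda>x\<in>U. f i x + g i x)
        (\<lambda>c f. \<lambda>i\<in>{..<r}. \<lambda>x\<in>U. c x * f i x)),
     res = (\<lambda>U W f. \<lambda>i\<in>{..<r}. restrict (f i) W)\<rparr>"

definition coherent :: "'a fspace \<Rightarrow> ('a, 'm) presheaf \<Rightarrow> bool" where
  "coherent X F \<longleftrightarrow> sheaf_of_modules X F \<and> finite_type X F \<and>
     (\<forall>U\<in>Opens X. \<forall>r s. (\<forall>i<r. s i \<in> sects F U) \<longrightarrow>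
        finite_type (restr X U) (relation_sheaf X F U r s))"

text \<open>On an irreducible variety this is torsion freeness of all stalks.\<close>

definition torsion_free :: "'a fspace \<Rightarrow> ('a, 'm) presheaf \<Rightarrow> bool" where
  "torsion_free X F \<longleftrightarrow> (\<forall>U\<in>Opens X. \<forall>f\<in>reg X U. \<forall>s\<in>sects F U.
     f \<odot>\<^bsub>sec F U\<^esub> s = \<zero>\<^bsub>sec F U\<^esub> \<longrightarrow> f = \<zero>\<^bsub>reg_ring X U\<^esub> \<or> s = \<zero>\<^bsub>sec F U\<^esub>)"

definition coherent_subsheaf :: "'a fspace \<Rightarrow> ('a, 'm) presheaf \<Rightarrow> ('a set \<Rightarrow> 'm set) \<Rightarrow> bool" where
  "coherent_subsheaf X F S \<longleftrightarrow> (\<forall>U\<in>Opens X. S U \<subseteq> sects F U) \<and> coherent X (subpresheaf F S)"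

text \<open>
  \<open>twist X F L m\<close> is the tensor product of \<open>F\<close> with the \<open>m\<close>-th tensor power of the line bundle \<open>L\<close>.
  As \<open>L\<close> is invertible, this is Hom from the \<open>m\<close>-th tensor power of the dual of \<open>L\<close> to \<open>F\<close>, that is,
  the sheaf of \<open>m\<close>-linear maps from the dual of \<open>L\<close> to \<open>F\<close>.
\<close>

definition tuples :: "('a, 'm) presheaf \<Rightarrow> nat \<Rightarrow> 'a set \<Rightarrow> 'm list set" where
  "tuples F m U = {ss. length ss = m \<and> set ss \<subseteq> sects F U}"

definition multilinear_map :: "'a fspace \<Rightarrow> ('a, 'k) presheaf \<Rightarrow> nat \<Rightarrow> ('a, 'm) presheaf \<Rightarrow>
    ('a set \<Rightarrow> 'k list \<Rightarrow> 'm) \<Rightarrow> bool" where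
  "multilinear_map X M m F h \<longleftrightarrow>
     (\<forall>U\<in>Opens X. \<forall>ss\<in>tuples M m U. h U ss \<in> sects F U \<and>
        (\<forall>i<m. \<forall>s\<in>sects M U. \<forall>t\<in>sects M U.
           h U (ss[i := s \<oplus>\<^bsub>sec M U\<^esub> t]) = h U (ss[i := s]) \<oplus>\<^bsub>sec F U\<^esub> h U (ss[i := t])) \<and>
        (\<forall>i<m. \<forall>f\<in>reg X U. \<forall>s\<in>sects M U.
           h U (ss[i := f \<odot>\<^bsub>sec M U\<^esub> s]) = f \<odot>\<^bsub>sec F U\<^esub> h U (ss[i := s])) \<and>
        (\<forall>W\<in>Opens X. W \<subseteq> U \<longrightarrow> h W (map (res M U W) ss) = res F U W (h U ss)))"

definition multilinear_sheaf :: "'a fspace \<Rightarrow> ('a, 'k) presheaf \<Rightarrow> nat \<Rightarrow> ('a, 'm) presheaf \<Rightarrow>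
    ('a, 'a set \<Rightarrow> 'k list \<Rightarrow> 'm) presheaf" where
  "multilinear_sheaf X M m F = \<lparr>
     sec = (\<lambda>U. mk_module
        {h \<in> (\<Pi>\<^sub>E W\<in>Opens (restr X U). extensional (tuples M m W)). multilinear_map (restr X U) M m F h}
        (\<lambda>W\<in>Opens (restr X U). \<lambda>ss\<in>tuples M m W. \<zero>\<^bsub>sec F W\<^esub>)
        (\<lambda>h k. \<lambda>W\<in>Opens (restr X U). \<lambda>ss\<in>tuples M m W. h W ss \<oplus>\<^bsub>sec F W\<^esub> k W ss)
        (\<lambda>f h. \<lambda>W\<in>Opens (restr X U). \<lambda>ss\<in>tuples M m W. restrict f W \<odot>\<^bsub>sec F W\<^esub> h W ss)),
     res = (\<lambda>U U' h. restrict h (Opens (restr X U')))\<rparr>"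

definition twist :: "'a fspace \<Rightarrow> ('a, 'm) presheaf \<Rightarrow> ('a, 'l) presheaf \<Rightarrow> nat \<Rightarrow>
    ('a, 'a set \<Rightarrow> ('a set \<Rightarrow> 'l \<Rightarrow> 'a \<Rightarrow> complex) list \<Rightarrow> 'm) presheaf" where
  "twist X F L m = multilinear_sheaf X (dual X L) m F"

text \<open>The set of points near which a section \<open>s\<close> over \<open>U\<close> of a line bundle is a generator.\<close>

definition nonvanishing_locus :: "'a fspace \<Rightarrow> ('a, 'm) presheaf \<Rightarrow> 'a set \<Rightarrow> 'm \<Rightarrow> 'a set" where
  "nonvanishing_locus X F U s = \<Union>{W \<in> Opens X. W \<subseteq> U \<and>
     (\<forall>W'\<in>Opens X. W' \<subseteq> W \<longrightarrow> (\<forall>t\<in>sects F W'. \<exists>f\<in>reg X W'. t = f \<odot>\<^bsub>sec F W'\<^esub> res F U W' s))}"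

text \<open>
  Ampleness of a line bundle: the affine non-vanishing loci of global sections of its positive
  tensor powers cover \<open>X\<close>.
\<close>

definition polarization :: "'a fspace \<Rightarrow> ('a, 'l) presheaf \<Rightarrow> bool" where
  "polarization X L \<longleftrightarrow> locally_free X L 1 \<and>
     (\<forall>x\<in>points X. \<exists>n\<ge>1. \<exists>s\<in>sects (twist X (OX X) L n) (points X).
        x \<in> nonvanishing_locus X (twist X (OX X) L n) (points X) s \<and>
        affine_open X (nonvanishing_locus X (twist X (OX X) L n) (points X) s))"

section \<open>Tangent sheaf and canonical sheaf\<close>

definition derivation :: "'a fspace \<Rightarrow> ('a set \<Rightarrow> ('a \<Rightarrow> complex) \<Rightarrow> 'a \<Rightarrow> complex) \<Rightarrow> bool" where
  "derivation X D \<longleftrightarrow> (\<forall>U\<in>Opens X. \<forall>f\<in>reg X U. D U f \<in> reg X U \<and>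
     (\<forall>c. \<forall>x\<in>U. D U (\<lambda>x\<in>U. c * f x) x = c * D U f x) \<and>
     (\<forall>g\<in>reg X U. \<forall>x\<in>U. D U (\<lambda>x\<in>U. f x + g x) x = D U f x + D U g x \<and>
                          D U (\<lambda>x\<in>U. f x * g x) x = f x * D U g x + g x * D U f x) \<and>
     (\<forall>W\<in>Opens X. W \<subseteq> U \<longrightarrow> D W (restrict f W) = restrict (D U f) W))"

definition tangent_sheaf :: "'a fspace \<Rightarrow> ('a, 'a set \<Rightarrow> ('a \<Rightarrow> complex) \<Rightarrow> 'a \<Rightarrow> complex) presheaf" where
  "tangent_sheaf X = \<lparr>
     sec = (\<lambda>U. mk_module
        {D \<in> (\<Pi>\<^sub>E W\<in>Opens (restr X U). extensional (reg X W)). derivation (restr X U) D}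
        (\<lambda>W\<in>Opens (restr X U). \<lambda>f\<in>reg X W. \<lambda>x\<in>W. 0)
        (\<lambda>D D'. \<lambda>W\<in>Opens (restr X U). \<lambda>f\<in>reg X W. \<lambda>x\<in>W. D W f x + D' W f x)
        (\<lambda>g D. \<lambda>W\<in>Opens (restr X U). \<lambda>f\<in>reg X W. \<lambda>x\<in>W. g x * D W f x)),
     res = (\<lambda>U U' D. restrict D (Opens (restr X U')))\<rparr>"

text \<open>
  The canonical sheaf of a smooth surface, as the sheaf of alternating bilinear forms on the
  tangent sheaf: a form is given as a homomorphism from the tangent sheaf to its dual.
\<close>

definition canonical_sheaf2 where
  "canonical_sheaf2 X = (let T = tangent_sheaf X; H = hom_sheaf X T (dual X T) in
     subpresheaf H (\<lambda>U. {b \<in> sects H U.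
        \<forall>W\<in>Opens X. W \<subseteq> U \<longrightarrow> (\<forall>D\<in>sects T W. b W D W D = (\<lambda>x\<in>W. 0))}))"

section \<open>Cohomology\<close>

text \<open>
  Dimension of the quotient of subspaces \<open>Z/B\<close> of a complex vector space \<open>M\<close> (finite-dimensional in
  all uses below).
\<close>

definition quot_dim :: "(complex, 'm) module \<Rightarrow> 'm set \<Rightarrow> 'm set \<Rightarrow> nat" where
  "quot_dim M Z B = (LEAST n. \<exists>S. finite S \<and> card S = n \<and> S \<subseteq> Z \<and>
     (\<forall>z\<in>Z. \<exists>c. \<exists>b\<in>B. z = b \<oplus>\<^bsub>M\<^esub> finsum M (\<lambda>s. c s \<odot>\<^bsub>M\<^esub> s) S))"

text \<open>
  Cech cohomology of a quasi-coherent sheaf on a projective variety, for the affine covering by the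
  complements of the coordinate hyperplanes, computed with the complex of all (not necessarily
  alternating) cochains; a \<open>p\<close>-simplex is a list of \<open>p + 1\<close> coordinates.
\<close>

definition std_open :: "('n::finite) pspace fspace \<Rightarrow> 'n list \<Rightarrow> 'n pspace set" where
  "std_open X is = {pt v | v. pt v \<in> points X \<and> (\<forall>i\<in>set is. v $ i \<noteq> 0)}"

definition simplices :: "nat \<Rightarrow> 'n list set" where
  "simplices p = {is. length is = p + 1}"

definition cochains :: "('n::finite) pspace fspace \<Rightarrow> ('n pspace, 'm) presheaf \<Rightarrow> nat \<Rightarrow>
    (complex, 'n list \<Rightarrow> 'm) module" where
  "cochains X F p = mk_module
     (\<Pi>\<^sub>E is\<in>simplices p. sects F (std_open X is))
     (\<lambda>is\<in>simplices p. \<zero>\<^bsub>sec F (std_open X is)\<^esub>)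
     (\<lambda>c c'. \<lambda>is\<in>simplices p. c is \<oplus>\<^bsub>sec F (std_open X is)\<^esub> c' is)
     (\<lambda>a c. \<lambda>is\<in>simplices p. (\<lambda>x\<in>std_open X is. a) \<odot>\<^bsub>sec F (std_open X is)\<^esub> c is)"

definition omit :: "nat \<Rightarrow> 'n list \<Rightarrow> 'n list" where
  "omit k is = take k is @ drop (Suc k) is"

definition coboundary :: "('n::finite) pspace fspace \<Rightarrow> ('n pspace, 'm) presheaf \<Rightarrow> nat \<Rightarrow>
    ('n list \<Rightarrow> 'm) \<Rightarrow> 'n list \<Rightarrow> 'm" where
  "coboundary X F p c = (\<lambda>is\<in>simplices (p + 1). finsum (sec F (std_open X is))
     (\<lambda>k. (\<lambda>x\<in>std_open X is. (-1) ^ k) \<odot>\<^bsub>sec F (std_open X is)\<^esub>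
            res F (std_open X (omit k is)) (std_open X is) (c (omit k is))) {..p + 1})"

definition cocycles :: "('n::finite) pspace fspace \<Rightarrow> ('n pspace, 'm) presheaf \<Rightarrow> nat \<Rightarrow> ('n list \<Rightarrow> 'm) set" where
  "cocycles X F p = {c \<in> carrier (cochains X F p). coboundary X F p c = \<zero>\<^bsub>cochains X F (p + 1)\<^esub>}"

definition coboundaries :: "('n::finite) pspace fspace \<Rightarrow> ('n pspace, 'm) presheaf \<Rightarrow> nat \<Rightarrow> ('n list \<Rightarrow> 'm) set" where
  "coboundaries X F p = (case p of 0 \<Rightarrow> {\<zero>\<^bsub>cochains X F 0\<^esub>}
     | Suc q \<Rightarrow> coboundary X F q ` carrier (cochains X F q))"

definition coh_dim :: "('n::finite) pspace fspace \<Rightarrow> ('n pspace, 'm) presheaf \<Rightarrow> nat \<Rightarrow> nat" where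
  "coh_dim X F p = quot_dim (cochains X F p) (cocycles X F p) (coboundaries X F p)"

text \<open>The covering has \<open>CARD('n)\<close> members, so cohomology vanishes in degrees \<open>\<ge> CARD('n)\<close>.\<close>

definition euler_char :: "('n::finite) pspace fspace \<Rightarrow> ('n pspace, 'm) presheaf \<Rightarrow> int" where
  "euler_char X F = (\<Sum>p<CARD('n). (-1) ^ p * int (coh_dim X F p))"

definition hilbert_poly :: "('n::finite) pspace fspace \<Rightarrow> ('n pspace, 'l) presheaf \<Rightarrow> ('n pspace, 'm) presheaf \<Rightarrow>
    nat \<Rightarrow> int" where
  "hilbert_poly X L F m = euler_char X (twist X F L m)"

definition reduced_hilbert :: "('n::finite) pspace fspace \<Rightarrow> ('n pspace, 'l) presheaf \<Rightarrow>
    ('n pspace, 'm) presheaf \<Rightarrow> nat \<Rightarrow> real" where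
  "reduced_hilbert X L F m = real_of_int (hilbert_poly X L F m) / real (sheaf_rank X F)"

definition K3_surface :: "('n::finite) pspace fspace \<Rightarrow> bool" where
  "K3_surface X \<longleftrightarrow>
     (\<exists>Z. closedin zariski Z \<and> irreducible_set zariski Z \<and> X = proj_variety Z) \<and>
     has_dimension X 2 \<and> nonsingular X 2 \<and>
     coh_dim X (OX X) 1 = 0 \<and>
     sheaf_iso X (canonical_sheaf2 X) (OX X)"

section \<open>Gieseker Harder-Narasimhan filtrations\<close>

definition gieseker_semistable ::
  "('n::finite) pspace fspace \<Rightarrow> ('n pspace, 'l) presheaf \<Rightarrow> ('n pspace, 'm) presheaf \<Rightarrow> bool" where
  "gieseker_semistable X L F \<longleftrightarrow> coherent X F \<and> torsion_free X F \<and>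
     (\<forall>S. coherent_subsheaf X F S \<and> nonzero_sheaf X (subpresheaf F S) \<and>
          sheaf_rank X (subpresheaf F S) < sheaf_rank X F \<longrightarrow>
        (\<forall>\<^sub>F m in sequentially. reduced_hilbert X L (subpresheaf F S) m \<le> reduced_hilbert X L F m))"

text \<open>
  A filtration of \<open>F\<close> is the list of its nonzero steps, the last one being \<open>F\<close>; \<open>graded_piece X F Fs i\<close>
  is the quotient of \<open>Fs ! i\<close> by the preceding step.
\<close>

definition graded_piece :: "'a fspace \<Rightarrow> ('a, 'm) presheaf \<Rightarrow> ('a set \<Rightarrow> 'm set) list \<Rightarrow> nat \<Rightarrow>
    ('a, 'a \<Rightarrow> ('a set \<times> 'm) set) presheaf" where
  "graded_piece X F Fs i =
     quot_sheaf X (subpresheaf F (Fs ! i)) (if i = 0 then zero_sub F else Fs ! (i - 1))"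

definition gieseker_HN_filtration :: "('n::finite) pspace fspace \<Rightarrow> ('n pspace, 'l) presheaf \<Rightarrow>
    ('n pspace, 'm) presheaf \<Rightarrow> ('n pspace set \<Rightarrow> 'm set) list \<Rightarrow> bool" where
  "gieseker_HN_filtration X L F Fs \<longleftrightarrow> coherent X F \<and> torsion_free X F \<and>
     Fs \<noteq> [] \<and> (\<forall>U\<in>Opens X. last Fs U = sects F U) \<and>
     (\<forall>i<length Fs. coherent_subsheaf X F (Fs ! i)) \<and>
     (\<forall>i. i + 1 < length Fs \<longrightarrow> (\<forall>U\<in>Opens X. (Fs ! i) U \<subseteq> (Fs ! (i + 1)) U)) \<and>
     (\<forall>i<length Fs. nonzero_sheaf X (graded_piece X F Fs i) \<and>
        torsion_free X (graded_piece X F Fs i) \<and> gieseker_semistable X L (graded_piece X F Fs i)) \<and>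
     (\<forall>i. i + 1 < length Fs \<longrightarrow> (\<forall>\<^sub>F m in sequentially.
        reduced_hilbert X L (graded_piece X F Fs i) m > reduced_hilbert X L (graded_piece X F Fs (i + 1)) m))"

definition same_filtration ::
  "'a fspace \<Rightarrow> ('a set \<Rightarrow> 'm set) list \<Rightarrow> ('a set \<Rightarrow> 'm set) list \<Rightarrow> bool" where
  "same_filtration X Fs Gs \<longleftrightarrow> length Fs = length Gs \<and>
     (\<forall>i<length Fs. \<forall>U\<in>Opens X. (Fs ! i) U = (Gs ! i) U)"

section \<open>The orthogonal group and its parabolic subgroups\<close>

definition O6 :: "(complex ^ 6 ^ 6) set" where
  "O6 = {g. transpose g ** g = mat 1}"

text \<open>Homomorphisms of algebraic groups from \<open>\<complex>\<^sup>*\<close>; the entries are Laurent polynomials.\<close>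

definition one_param_subgroup :: "(complex \<Rightarrow> complex ^ 6 ^ 6) \<Rightarrow> bool" where
  "one_param_subgroup lam \<longleftrightarrow> (\<forall>t. t \<noteq> 0 \<longrightarrow> lam t \<in> O6) \<and>
     (\<forall>s t. s \<noteq> 0 \<and> t \<noteq> 0 \<longrightarrow> lam (s * t) = lam s ** lam t) \<and>
     (\<exists>N :: int. \<exists>a. \<forall>t i j. t \<noteq> 0 \<longrightarrow> lam t $ i $ j = (\<Sum>k\<in>{-N..N}. a i j k * t powi k))"

definition parabolic :: "(complex \<Rightarrow> complex ^ 6 ^ 6) \<Rightarrow> (complex ^ 6 ^ 6) set" where
  "parabolic lam = {g \<in> O6. \<exists>g'\<in>O6. ((\<lambda>t. lam t ** g ** matrix_inv (lam t)) \<longlongrightarrow> g') at_infinity}"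

definition weight_space :: "(complex \<Rightarrow> complex ^ 6 ^ 6) \<Rightarrow> int \<Rightarrow> (complex ^ 6) set" where
  "weight_space lam \<gamma> = {v. \<forall>t. t \<noteq> 0 \<longrightarrow> lam t *v v = (t powi \<gamma>) *s v}"

definition weights :: "(complex \<Rightarrow> complex ^ 6 ^ 6) \<Rightarrow> int set" where
  "weights lam = {\<gamma>. weight_space lam \<gamma> \<noteq> {0}}"

text \<open>The sum of the weight spaces of all weights \<open>\<le> \<gamma>\<close>.\<close>

definition weight_step :: "(complex \<Rightarrow> complex ^ 6 ^ 6) \<Rightarrow> int \<Rightarrow> (complex ^ 6) set" where
  "weight_step lam \<gamma> = {(\<Sum>\<delta> | \<delta> \<in> weights lam \<and> \<delta> \<le> \<gamma>. w \<delta>) | w. \<forall>\<delta>. w \<delta> \<in> weight_space lam \<delta>}"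

section \<open>Orthogonal frame bundle and parabolic reductions\<close>

text \<open>
  The principal \<open>O6\<close>-bundle of a rank 6 bundle \<open>F\<close> with symmetric nondegenerate form \<open>\<phi>\<close>, acting on
  the right by composition, is the bundle of isometries \<open>e\<close> from \<open>\<complex>\<^sup>6\<close> with its standard form to
  the fibre of \<open>F\<close> at \<open>x\<close>.  Here \<open>e\<close> is represented by its inverse \<open>\<epsilon>\<close>, a linear map on the fibre
  of \<open>F\<close> at \<open>x\<close>, that is, a map on germs of sections at \<open>x\<close> which is linear over the evaluation of
  regular functions at \<open>x\<close>; so \<open>\<epsilon> W s\<close> is the coordinate vector of the value \<open>s(x)\<close> in the frame
  \<open>e\<close>, and \<open>e \<circ> g\<close> is represented by \<open>g\<^sup>-\<^sup>1 \<epsilon>\<close>.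
\<close>

type_synonym ('a, 'm) frame = "'a \<times> ('a set \<Rightarrow> 'm \<Rightarrow> complex ^ 6)"

definition frames :: "'a fspace \<Rightarrow> ('a, 'm) presheaf \<Rightarrow> ('a set \<Rightarrow> 'm \<Rightarrow> 'm \<Rightarrow> 'a \<Rightarrow> complex) \<Rightarrow>
    ('a, 'm) frame set" where
  "frames X F \<phi> = {(x, \<epsilon>). x \<in> points X \<and>
     \<epsilon> \<in> (\<Pi>\<^sub>E W\<in>{W \<in> Opens X. x \<in> W}. extensional (sects F W)) \<and>
     (\<forall>W\<in>Opens X. x \<in> W \<longrightarrow>
        (\<forall>s\<in>sects F W. \<forall>t\<in>sects F W. \<epsilon> W (s \<oplus>\<^bsub>sec F W\<^esub> t) = \<epsilon> W s + \<epsilon> W t) \<and>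
        (\<forall>f\<in>reg X W. \<forall>s\<in>sects F W. \<epsilon> W (f \<odot>\<^bsub>sec F W\<^esub> s) = f x *s \<epsilon> W s) \<and>
        (\<forall>W'\<in>Opens X. x \<in> W' \<and> W' \<subseteq> W \<longrightarrow> (\<forall>s\<in>sects F W. \<epsilon> W' (res F W W' s) = \<epsilon> W s)) \<and>
        (\<forall>s\<in>sects F W. \<forall>t\<in>sects F W. \<phi> W s t x = (\<Sum>k\<in>UNIV. \<epsilon> W s $ k * \<epsilon> W t $ k))) \<and>
     (\<forall>v. \<exists>W\<in>Opens X. x \<in> W \<and> (\<exists>s\<in>sects F W. \<epsilon> W s = v))}"

definition frame_act :: "'a fspace \<Rightarrow> ('a, 'm) presheaf \<Rightarrow> complex ^ 6 ^ 6 \<Rightarrow> ('a, 'm) frame \<Rightarrow> ('a, 'm) frame" where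
  "frame_act X F g = (\<lambda>(x, \<epsilon>). (x, \<lambda>W\<in>{W \<in> Opens X. x \<in> W}. \<lambda>s\<in>sects F W. matrix_inv g *v \<epsilon> W s))"

text \<open>
  Functions on the part of the total space over \<open>W\<close> that are polynomial in the frame coordinates of
  sections of \<open>F\<close> over \<open>W\<close>, with coefficients regular functions on \<open>W\<close>.  (By orthogonality the
  entries of \<open>e\<close> with respect to a local basis are linear combinations of entries of \<open>\<epsilon>\<close>.)  The
  variety structure of the total space is given by quotients of such functions.
\<close>

inductive_set frame_poly :: "'a fspace \<Rightarrow> ('a, 'm) presheaf \<Rightarrow> 'a set \<Rightarrow> (('a, 'm) frame \<Rightarrow> complex) set"
  for X F W where
  base: "f \<in> reg X W \<Longrightarrow> (\<lambda>e. f (fst e)) \<in> frame_poly X F W"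
| coord: "s \<in> sects F W \<Longrightarrow> (\<lambda>e. snd e W s $ k) \<in> frame_poly X F W"
| add: "p \<in> frame_poly X F W \<Longrightarrow> q \<in> frame_poly X F W \<Longrightarrow> (\<lambda>e. p e + q e) \<in> frame_poly X F W"
| mult: "p \<in> frame_poly X F W \<Longrightarrow> q \<in> frame_poly X F W \<Longrightarrow> (\<lambda>e. p e * q e) \<in> frame_poly X F W"

definition frame_bundle :: "'a fspace \<Rightarrow> ('a, 'm) presheaf \<Rightarrow> ('a set \<Rightarrow> 'm \<Rightarrow> 'm \<Rightarrow> 'a \<Rightarrow> complex) \<Rightarrow>
    ('a, 'm) frame fspace" where
  "frame_bundle X F \<phi> = \<lparr>
     topo = topology_generated_by
        {{e \<in> frames X F \<phi>. fst e \<in> W \<and> q e \<noteq> 0} | W q. W \<in> Opens X \<and> q \<in> frame_poly X F W},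
     reg = (\<lambda>S. {f \<in> extensional S. \<forall>e\<in>S. \<exists>W\<in>Opens X. \<exists>p\<in>frame_poly X F W. \<exists>q\<in>frame_poly X F W.
        fst e \<in> W \<and> q e \<noteq> 0 \<and> (\<forall>e'\<in>S. fst e' \<in> W \<and> q e' \<noteq> 0 \<longrightarrow> f e' = p e' / q e')})\<rparr>"

text \<open>
  The quotient of a variety by a group action, as a space with functions: quotient topology, and
  functions whose pullback is regular.  The sets generating the topology already form a topology.
\<close>

definition orbit_space :: "'e fspace \<Rightarrow> ('g \<Rightarrow> 'e \<Rightarrow> 'e) \<Rightarrow> 'g set \<Rightarrow> 'e set fspace" where
  "orbit_space E act P = (let orb = (\<lambda>e. (\<lambda>g. act g e) ` P) in \<lparr>
     topo = topology_generated_by {S. S \<subseteq> orb ` points E \<and> \<Union>S \<in> Opens E},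
     reg = (\<lambda>S. {f \<in> extensional S. (\<lambda>e\<in>\<Union>S. f (orb e)) \<in> reg E (\<Union>S)})\<rparr>)"

text \<open>A reduction of structure group to \<open>P\<close> over \<open>U\<close>: a section over \<open>U\<close> of \<open>E/P \<rightarrow> X\<close>.\<close>

definition reduction :: "'a fspace \<Rightarrow> ('a, 'm) presheaf \<Rightarrow> ('a set \<Rightarrow> 'm \<Rightarrow> 'm \<Rightarrow> 'a \<Rightarrow> complex) \<Rightarrow>
    (complex ^ 6 ^ 6) set \<Rightarrow> 'a set \<Rightarrow> ('a \<Rightarrow> ('a, 'm) frame set) \<Rightarrow> bool" where
  "reduction X F \<phi> P U \<sigma> \<longleftrightarrow>
     fs_morphism (restr X U) (orbit_space (frame_bundle X F \<phi>) (frame_act X F) P) \<sigma> \<and>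
     (\<forall>x\<in>U. \<forall>e\<in>\<sigma> x. fst e = x)"

text \<open>
  The intersection with \<open>F\<close> of the push-forward from \<open>U\<close> of the subbundle associated with \<open>\<sigma>\<close> and
  the subspace \<open>weight_step lam \<gamma>\<close>: sections over \<open>W\<close> whose values over \<open>W \<inter> U\<close> lie in the subbundle.
\<close>

definition reduction_step :: "('a, 'm) presheaf \<Rightarrow> (complex \<Rightarrow> complex ^ 6 ^ 6) \<Rightarrow> 'a set \<Rightarrow>
    ('a \<Rightarrow> ('a, 'm) frame set) \<Rightarrow> int \<Rightarrow> 'a set \<Rightarrow> 'm set" where
  "reduction_step F lam U \<sigma> \<gamma> W =
     {s \<in> sects F W. \<forall>x\<in>W \<inter> U. \<forall>e\<in>\<sigma> x. snd e W s \<in> weight_step lam \<gamma>}"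

definition corresponds_to_parabolic_reduction :: "'a fspace \<Rightarrow> ('a, 'm) presheaf \<Rightarrow>
    ('a set \<Rightarrow> 'm \<Rightarrow> 'm \<Rightarrow> 'a \<Rightarrow> complex) \<Rightarrow> ('a set \<Rightarrow> 'm set) list \<Rightarrow> bool" where
  "corresponds_to_parabolic_reduction X F \<phi> Fs \<longleftrightarrow>
     (\<exists>lam U \<sigma>. one_param_subgroup lam \<and> big_open X U \<and> reduction X F \<phi> (parabolic lam) U \<sigma> \<and>
        same_filtration X Fs (map (reduction_step F lam U \<sigma>) (sorted_list_of_set (weights lam))))"

section \<open>The bundle \<open>V \<oplus> V\<^sup>\<or>\<close>\<close>

definition duality_form :: "'a set \<Rightarrow> 'v \<times> ('a set \<Rightarrow> 'v \<Rightarrow> 'a \<Rightarrow> complex) \<Rightarrow>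
    'v \<times> ('a set \<Rightarrow> 'v \<Rightarrow> 'a \<Rightarrow> complex) \<Rightarrow> 'a \<Rightarrow> complex" where
  "duality_form W = (\<lambda>(v, f) (w, g). \<lambda>x\<in>W. f W w x + g W v x)"

text \<open>The image of the dual \<open>c \<mapsto> c \<beta>\<close> of a homomorphism \<open>\<beta>\<close> from \<open>V\<close> to the structure sheaf.\<close>

definition dual_image :: "'a fspace \<Rightarrow> ('a, 'v) presheaf \<Rightarrow> ('a set \<Rightarrow> 'v \<Rightarrow> 'a \<Rightarrow> complex) \<Rightarrow> 'a set \<Rightarrow>
    ('a set \<Rightarrow> 'v \<Rightarrow> 'a \<Rightarrow> complex) set" where
  "dual_image X V \<beta> U =
     {\<lambda>W\<in>Opens (restr X U). \<lambda>v\<in>sects V W. \<lambda>x\<in>W. c x * \<beta> W v x | c. c \<in> reg X U}"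

definition displayed_filtration :: "'a fspace \<Rightarrow> ('a, 'v) presheaf \<Rightarrow> ('a set \<Rightarrow> 'v \<Rightarrow> 'a \<Rightarrow> complex) \<Rightarrow>
    ('a set \<Rightarrow> ('v \<times> ('a set \<Rightarrow> 'v \<Rightarrow> 'a \<Rightarrow> complex)) set) list" where
  "displayed_filtration X V \<beta> =
     [\<lambda>U. {\<zero>\<^bsub>sec V U\<^esub>} \<times> dual_image X V \<beta> U,
      \<lambda>U. sects V U \<times> dual_image X V \<beta> U,
      \<lambda>U. sects V U \<times> sects (dual X V) U]"

end

theory Submission
  imports Defs
begin

text \<open>
  A one parameter subgroup of \<open>O6\<close> whose weight spaces span \<open>\<complex>\<^sup>6\<close> has a set of weights symmetric
  about \<open>0\<close>, since weight spaces of weights \<open>\<gamma>\<close> and \<open>\<delta>\<close> are orthogonal unless \<open>\<gamma> + \<delta> = 0\<close>.  With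
  three weights they are therefore \<open>-a < 0 < a\<close>, so the first step of a filtration given by a
  reduction is orthogonal to the second.  But near any point there is a section \<open>v\<close> of \<open>V\<close> with
  \<open>\<beta> v = 1\<close>, and \<open>(0, \<beta>)\<close> and \<open>(v, 0)\<close>, which lie in the first and second displayed steps, pair to \<open>1\<close>.
\<close>

section \<open>The standard complex bilinear form and the weights of a one parameter
  subgroup\<close>

definition bilin :: "complex ^ 6 \<Rightarrow> complex ^ 6 \<Rightarrow> complex" where
  "bilin v w = (\<Sum>k\<in>UNIV. v $ k * w $ k)"

lemma bilin_sum_left: "bilin (\<Sum>i\<in>A. f i) w = (\<Sum>i\<in>A. bilin (f i) w)"
  unfolding bilin_def by (simp add: sum_distrib_right) (rule sum.swap)

lemma bilin_sum_right: "bilin v (\<Sum>i\<in>A. f i) = (\<Sum>i\<in>A. bilin v (f i))"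
  unfolding bilin_def by (simp add: sum_distrib_left) (rule sum.swap)

lemma bilin_smult: "bilin (a *s v) (b *s w) = a * b * bilin v w"
  unfolding bilin_def by (simp add: sum_distrib_left mult_ac)

lemma bilin_nondegenerate:
  assumes "\<And>w. bilin v w = 0"
  shows "v = 0"
proof -
  have "v $ i = 0" for i
  proof -
    have "bilin v (axis i 1) = v $ i"
      by (simp add: bilin_def axis_def if_distrib sum.delta cong: if_cong)
    with assms show ?thesis by simp
  qed
  then show ?thesis by (simp add: vec_eq_iff)
qed

lemma bilin_matrix_left: "bilin (g *v v) w = bilin v (transpose g *v w)"
proof -
  have "bilin (g *v v) w = (\<Sum>k\<in>UNIV. \<Sum>i\<in>UNIV. v $ i * (g $ k $ i * w $ k))"
    by (simp add: bilin_def matrix_vector_mult_def sum_distrib_right)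
      (intro sum.cong refl, simp add: mult_ac)
  also have "\<dots> = (\<Sum>i\<in>UNIV. \<Sum>k\<in>UNIV. v $ i * (g $ k $ i * w $ k))"
    by (rule sum.swap)
  also have "\<dots> = bilin v (transpose g *v w)"
    by (simp add: bilin_def matrix_vector_mult_def transpose_def sum_distrib_left)
  finally show ?thesis .
qed

lemma bilin_O6:
  assumes "g \<in> O6"
  shows "bilin (g *v v) (g *v w) = bilin v w"
  using assms by (simp add: bilin_matrix_left matrix_vector_mul_assoc O6_def)

text \<open>Each \<open>lam t\<close> preserves the form but scales the pairing by the power
  \<open>\<gamma> + \<delta>\<close> of \<open>t\<close>. The single parameter 2 suffices: its
  nonzero integer powers have modulus different from 1.\<close>

lemma weight_spaces_orthogonal:
  assumes "one_param_subgroup lam" "v \<in> weight_space lam \<gamma>" "w \<in> weight_space lam \<delta>" "\<gamma> + \<delta> \<noteq> 0"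
  shows "bilin v w = 0"
proof -
  have "bilin v w = bilin (lam 2 *v v) (lam 2 *v w)"
    using assms(1) by (simp add: bilin_O6 one_param_subgroup_def)
  also have "\<dots> = 2 powi (\<gamma> + \<delta>) * bilin v w"
    using assms(2,3) by (simp add: weight_space_def bilin_smult power_int_add)
  finally have *: "bilin v w = 2 powi (\<gamma> + \<delta>) * bilin v w" .
  have "norm ((2::complex) powi (\<gamma> + \<delta>)) \<noteq> 1"
    using assms(4) power_int_strict_increasing[of "\<gamma> + \<delta>" 0 "2::real"]
      power_int_strict_increasing[of 0 "\<gamma> + \<delta>" "2::real"]
    by (cases "\<gamma> + \<delta> < 0") (auto simp: norm_power_int)
  then have "(2::complex) powi (\<gamma> + \<delta>) \<noteq> 1" by force
  with * show ?thesis by simp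
qed

lemma weight_stepE:
  assumes "v \<in> weight_step lam \<gamma>"
  obtains w where "v = (\<Sum>\<delta> | \<delta> \<in> weights lam \<and> \<delta> \<le> \<gamma>. w \<delta>)" "\<And>\<delta>. w \<delta> \<in> weight_space lam \<delta>"
  using assms unfolding weight_step_def by blast

text \<open>If \<open>- \<gamma>\<close> were not a weight, a vector of weight
  \<open>\<gamma>\<close> would be orthogonal to all weight vectors, hence to everything, hence
  zero. The hypothesis \<open>full\<close> expresses that \<open>lam\<close> is
  diagonalizable.\<close>

lemma weights_symmetric:
  assumes lam: "one_param_subgroup lam" and full: "weight_step lam \<eta> = UNIV" and "\<gamma> \<in> weights lam"
  shows "- \<gamma> \<in> weights lam"
proof (rule ccontr)
  assume neg: "- \<gamma> \<notin> weights lam"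
  have "v = 0" if v: "v \<in> weight_space lam \<gamma>" for v
  proof (rule bilin_nondegenerate)
    fix u
    obtain w where u: "u = (\<Sum>\<delta> | \<delta> \<in> weights lam \<and> \<delta> \<le> \<eta>. w \<delta>)"
      and w: "\<And>\<delta>. w \<delta> \<in> weight_space lam \<delta>"
      using full weight_stepE by blast
    have "bilin v (w \<delta>) = 0" if "\<delta> \<in> weights lam" for \<delta>
      by (rule weight_spaces_orthogonal[OF lam v w]) (use neg that in \<open>auto simp: add_eq_0_iff\<close>)
    then show "bilin v u = 0"
      by (simp add: u bilin_sum_right)
  qed
  \<comment> \<open>\<open>weights\<close> only asks that the weight space differ from
    \<open>{0}\<close>, so the empty set has to be excluded.\<close>
  moreover have "0 \<in> weight_space lam \<gamma>"
    by (simp add: weight_space_def)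
  ultimately show False
    using \<open>\<gamma> \<in> weights lam\<close> by (auto simp: weights_def)
qed

lemma weight_steps_orthogonal:
  assumes lam: "one_param_subgroup lam"
    and weights: "weights lam = {\<gamma>1, \<gamma>2, \<gamma>3}" "\<gamma>1 < \<gamma>2" "\<gamma>2 < \<gamma>3"
    and full: "weight_step lam \<gamma>3 = UNIV"
    and v: "v \<in> weight_step lam \<gamma>1" and u: "u \<in> weight_step lam \<gamma>2"
  shows "bilin v u = 0"
proof -
  have "- \<gamma> \<in> {\<gamma>1, \<gamma>2, \<gamma>3}" if "\<gamma> \<in> {\<gamma>1, \<gamma>2, \<gamma>3}" for \<gamma>
    using weights_symmetric[OF lam full] that by (simp add: weights)
  \<comment> \<open>Negation reverses the order of the three weights, so it swaps the outer two and
    fixes the middle one. Sums of a weight up to \<open>\<gamma>1\<close> and one up to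
    \<open>\<gamma>2\<close> are then negative.\<close>
  from this[of \<gamma>1] this[of \<gamma>2] this[of \<gamma>3] weights(2,3) have neg: "\<gamma>1 < 0" "\<gamma>2 = 0"
    by auto
  obtain a where a: "v = (\<Sum>\<delta> | \<delta> \<in> weights lam \<and> \<delta> \<le> \<gamma>1. a \<delta>)" "\<And>\<delta>. a \<delta> \<in> weight_space lam \<delta>"
    using v weight_stepE by blast
  obtain b where b: "u = (\<Sum>\<delta> | \<delta> \<in> weights lam \<and> \<delta> \<le> \<gamma>2. b \<delta>)" "\<And>\<delta>. b \<delta> \<in> weight_space lam \<delta>"
    using u weight_stepE by blast
  have "bilin (a \<gamma>) (b \<delta>) = 0" if "\<gamma> \<le> \<gamma>1" "\<delta> \<le> \<gamma>2" for \<gamma> \<delta>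
    using weight_spaces_orthogonal[OF lam a(2) b(2)] that neg by simp
  then show ?thesis
    by (simp add: a(1) b(1) bilin_sum_left bilin_sum_right)
qed

section \<open>From a parabolic reduction to a frame adapted to its filtration\<close>

lemma matrix_matrix_inv:
  assumes "invertible A"
  shows "A ** matrix_inv A = mat 1"
  using assms someI_ex[of "\<lambda>A'. A ** A' = mat 1 \<and> A' ** A = mat 1"]
  by (simp add: invertible_def matrix_inv_def)

text \<open>Ensures that orbits under the parabolic are nonempty. The conjugate is constant for
  \<open>t \<noteq> 0\<close>, and the limit at infinity ignores \<open>t = 0\<close>, where
  \<open>lam t\<close> is arbitrary.\<close>

lemma mat_1_in_parabolic:
  assumes "one_param_subgroup lam"
  shows "mat 1 \<in> parabolic lam"
proof -
  have "lam t ** mat 1 ** matrix_inv (lam t) = mat 1" if "t \<noteq> 0" for t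
  proof -
    have "transpose (lam t) ** lam t = mat 1"
      using assms that by (simp add: one_param_subgroup_def O6_def)
    then have "invertible (lam t)"
      by (meson invertible_def matrix_left_right_inverse)
    then show ?thesis
      by (simp add: matrix_matrix_inv)
  qed
  then have "\<forall>\<^sub>F t in at_infinity. lam t ** mat 1 ** matrix_inv (lam t) = mat 1"
    by (rule eventually_mono[OF eventually_not_equal_at_infinity])
  then have "((\<lambda>t. lam t ** mat 1 ** matrix_inv (lam t)) \<longlongrightarrow> mat 1) at_infinity"
    by (rule tendsto_eventually)
  moreover have "mat 1 \<in> O6"
    by (simp add: O6_def transpose_mat)
  ultimately show ?thesis
    unfolding parabolic_def by blast
qed

lemma points_orbit_space: "points (orbit_space E act P) \<subseteq> (\<lambda>e. (\<lambda>g. act g e) ` P) ` points E"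
  by (auto simp: points_def orbit_space_def Let_def topology_generated_by_topspace)

lemma points_frame_bundle: "points (frame_bundle X F \<phi>) \<subseteq> frames X F \<phi>"
  by (auto simp: points_def frame_bundle_def topology_generated_by_topspace)

lemma reduction_frame:
  assumes red: "reduction X F \<phi> P U \<sigma>" and P: "mat 1 \<in> P" and x: "x \<in> U" "x \<in> points X"
  obtains \<epsilon> where "(x, \<epsilon>) \<in> frames X F \<phi>"
    "\<And>\<gamma> lam W s. W \<in> Opens X \<Longrightarrow> x \<in> W \<Longrightarrow> s \<in> reduction_step F lam U \<sigma> \<gamma> W \<Longrightarrow> \<epsilon> W s \<in> weight_step lam \<gamma>"
proof -
  have "continuous_map (topo (restr X U)) (topo (orbit_space (frame_bundle X F \<phi>) (frame_act X F) P)) \<sigma>"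
    using red by (simp add: reduction_def fs_morphism_def)
  moreover have "x \<in> topspace (topo (restr X U))"
    using x by (simp add: restr_def points_def)
  ultimately have "\<sigma> x \<in> points (orbit_space (frame_bundle X F \<phi>) (frame_act X F) P)"
    unfolding continuous_map_def points_def by blast
  then obtain e where e: "e \<in> frames X F \<phi>" and \<sigma>: "\<sigma> x = (\<lambda>g. frame_act X F g e) ` P"
    using points_orbit_space points_frame_bundle by blast
  obtain y \<epsilon> where y: "e = (y, \<epsilon>)" by (cases e)
  \<comment> \<open>\<open>reduction\<close> and \<open>reduction_step\<close> quantify over all
    members of \<open>\<sigma> x\<close>. The translate of \<open>e\<close> by the identity is a
    concrete one, and it places \<open>e\<close> over \<open>x\<close>.\<close>
  have in_\<sigma>: "frame_act X F (mat 1) e \<in> \<sigma> x"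
    using P by (simp add: \<sigma>)
  then have "fst (frame_act X F (mat 1) e) = x"
    using red x by (auto simp: reduction_def)
  then have "y = x" by (simp add: y frame_act_def)
  have inv: "matrix_inv (mat 1 :: complex ^ 6 ^ 6) = mat 1"
    using matrix_matrix_inv[of "mat 1 :: complex ^ 6 ^ 6"] by (simp add: invertible_def)
  show thesis
  proof
    show "(x, \<epsilon>) \<in> frames X F \<phi>"
      using e y \<open>y = x\<close> by simp
    fix \<gamma> lam W s
    assume W: "W \<in> Opens X" "x \<in> W" and s: "s \<in> reduction_step F lam U \<sigma> \<gamma> W"
    then have "snd (frame_act X F (mat 1) e) W s \<in> weight_step lam \<gamma>"
      using in_\<sigma> x by (auto simp: reduction_step_def)
    moreover have "s \<in> sects F W"
      using s by (simp add: reduction_step_def)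
    ultimately show "\<epsilon> W s \<in> weight_step lam \<gamma>"
      using W by (simp add: frame_act_def y \<open>y = x\<close> inv)
  qed
qed

lemma same_filtration_sym: "same_filtration X Fs Gs \<Longrightarrow> same_filtration X Gs Fs"
  by (simp add: same_filtration_def)

lemma same_filtration_trans:
  "same_filtration X Fs Gs \<Longrightarrow> same_filtration X Gs Hs \<Longrightarrow> same_filtration X Fs Hs"
  by (simp add: same_filtration_def)

lemma corresponds_to_parabolic_reduction_cong:
  assumes "corresponds_to_parabolic_reduction X F \<phi> Fs" "same_filtration X Fs Gs"
  shows "corresponds_to_parabolic_reduction X F \<phi> Gs"
  using assms same_filtration_sym same_filtration_trans
  unfolding corresponds_to_parabolic_reduction_def by metis

text \<open>A frame in the reduction carries \<open>\<phi>\<close> at \<open>x\<close> to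
  \<open>bilin\<close> and sections of the first two sheaves into the first two weight steps, which
  are orthogonal.\<close>

lemma parabolic_reduction_first_two_steps_orthogonal:
  assumes "corresponds_to_parabolic_reduction X F \<phi> [F1, F2, F3]"
    and full: "\<And>W. W \<in> Opens X \<Longrightarrow> F3 W = sects F W"
  obtains U where "big_open X U"
    "\<And>x W s t. x \<in> U \<Longrightarrow> W \<in> Opens X \<Longrightarrow> x \<in> W \<Longrightarrow> s \<in> F1 W \<Longrightarrow> t \<in> F2 W \<Longrightarrow> \<phi> W s t x = 0"
proof -
  from assms(1) obtain lam U \<sigma> where lam: "one_param_subgroup lam" and U: "big_open X U"
    and red: "reduction X F \<phi> (parabolic lam) U \<sigma>"
    and same: "same_filtration X [F1, F2, F3]
      (map (reduction_step F lam U \<sigma>) (sorted_list_of_set (weights lam)))"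
    unfolding corresponds_to_parabolic_reduction_def by blast
  have "length (sorted_list_of_set (weights lam)) = 3"
    using same by (simp add: same_filtration_def)
  then obtain \<gamma>1 \<gamma>2 \<gamma>3 where sorted: "sorted_list_of_set (weights lam) = [\<gamma>1, \<gamma>2, \<gamma>3]"
    unfolding numeral_3_eq_3 length_Suc_conv by auto
  \<comment> \<open>\<open>sorted_list_of_set\<close> returns the empty list on infinite
    sets.\<close>
  have "finite (weights lam)"
    using sorted by (metis list.distinct(1) sorted_list_of_set.fold_insort_key.infinite)
  then have weights: "weights lam = {\<gamma>1, \<gamma>2, \<gamma>3}"
    using sorted set_sorted_list_of_set by fastforce
  have less: "\<gamma>1 < \<gamma>2" "\<gamma>2 < \<gamma>3"
    using strict_sorted_list_of_set[of "weights lam"] by (simp_all add: sorted)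
  have steps: "F1 W = reduction_step F lam U \<sigma> \<gamma>1 W" "F2 W = reduction_step F lam U \<sigma> \<gamma>2 W"
      "F3 W = reduction_step F lam U \<sigma> \<gamma>3 W" if "W \<in> Opens X" for W
  proof -
    have "([F1, F2, F3] ! i) W = (map (reduction_step F lam U \<sigma>) [\<gamma>1, \<gamma>2, \<gamma>3] ! i) W" if "i < 3" for i
      using same that \<open>W \<in> Opens X\<close> by (simp add: same_filtration_def sorted)
    from this[of 0] this[of 1] this[of 2] show "F1 W = reduction_step F lam U \<sigma> \<gamma>1 W"
      "F2 W = reduction_step F lam U \<sigma> \<gamma>2 W" "F3 W = reduction_step F lam U \<sigma> \<gamma>3 W"
      by simp_all
  qed
  show thesis
  proof
    show "big_open X U" by fact
    fix x W s t
    assume x: "x \<in> U" "x \<in> W" and W: "W \<in> Opens X" and s: "s \<in> F1 W" and t: "t \<in> F2 W"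
    have "x \<in> points X"
      using x W by (auto simp: Opens_def points_def dest: openin_subset)
    then obtain \<epsilon> where \<epsilon>: "(x, \<epsilon>) \<in> frames X F \<phi>"
      and step: "\<And>\<gamma> lam W s. W \<in> Opens X \<Longrightarrow> x \<in> W \<Longrightarrow> s \<in> reduction_step F lam U \<sigma> \<gamma> W \<Longrightarrow>
        \<epsilon> W s \<in> weight_step lam \<gamma>"
      using reduction_frame[OF red mat_1_in_parabolic[OF lam] x(1)] by metis
    have surj: "\<forall>v. \<exists>W\<in>Opens X. x \<in> W \<and> (\<exists>s\<in>sects F W. \<epsilon> W s = v)"
      using \<epsilon> by (simp add: frames_def)
    \<comment> \<open>Every vector is the frame value of some section, and all sections belong to
      the last step. This yields the spanning hypothesis on the weight spaces.\<close>
    have "v \<in> weight_step lam \<gamma>3" for v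
    proof -
      obtain W' s' where "W' \<in> Opens X" "x \<in> W'" "s' \<in> sects F W'" "\<epsilon> W' s' = v"
        using surj by blast
      then show ?thesis
        using step[of W' s' lam \<gamma>3] steps(3)[of W'] full[of W'] by simp
    qed
    then have "weight_step lam \<gamma>3 = UNIV" by blast
    moreover have "\<epsilon> W s \<in> weight_step lam \<gamma>1" "\<epsilon> W t \<in> weight_step lam \<gamma>2"
      using s t by (simp_all add: step W x(2) steps[OF W])
    ultimately have "bilin (\<epsilon> W s) (\<epsilon> W t) = 0"
      by (rule weight_steps_orthogonal[OF lam weights less])
    moreover have "s \<in> sects F W" "t \<in> sects F W"
      using s t steps W by (auto simp: reduction_step_def)
    ultimately show "\<phi> W s t x = 0"
      using \<epsilon> W x(2) by (simp add: frames_def bilin_def)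
  qed
qed

section \<open>Points of a big open set, and sections of the displayed steps that pair to 1\<close>

text \<open>Were \<open>U\<close> empty, the whole space would be an irreducible closed subset of
  its complement, and codimension 2 would demand a strictly larger closed set.\<close>

lemma big_open_nonempty:
  assumes "big_open X U" and irr: "irreducible_set (topo X) (points X)"
  shows "U \<noteq> {}"
proof
  assume "U = {}"
  then obtain Z1 Z2 where "irr_chain (topo X) [points X, Z1, Z2]"
    using assms by (auto simp: big_open_def points_def)
  then have "points X \<subset> Z1" "Z1 \<subseteq> topspace (topo X)"
    by (auto simp: irr_chain_def irreducible_set_def)
  then show False
    by (auto simp: points_def)
qed

text \<open>Since \<open>Z\<close> is closed, closed subsets in its subspace topology are closed in
  \<open>zariski\<close>, so irreducibility carries over.\<close>

lemma K3_surface_irreducible: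
  assumes "K3_surface X"
  shows "irreducible_set (topo X) (points X)"
proof -
  obtain Z where Z: "closedin zariski Z" "irreducible_set zariski Z" "X = proj_variety Z"
    using assms by (auto simp: K3_surface_def)
  have "points X = Z"
    using Z by (auto simp: points_def proj_variety_def irreducible_set_def)
  then show ?thesis
    using Z by (auto simp: proj_variety_def irreducible_set_def closedin_closed_subtopology)
qed

lemma displayed_filtration_steps_not_orthogonal:
  assumes V: "sheaf_of_modules X V" and exact: "short_exact X A V (OX X) \<alpha> \<beta>" and x: "x \<in> points X"
  obtains W s t where "W \<in> Opens X" "x \<in> W" "s \<in> (displayed_filtration X V \<beta> ! 0) W"
    "t \<in> (displayed_filtration X V \<beta> ! 1) W" "duality_form W s t x = 1"
proof -
  have module: "Module.module (reg_ring X U) (sec V U)" if "U \<in> Opens X" for U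
    using V that by (simp add: sheaf_of_modules_def)
  \<comment> \<open>The module axioms include that \<open>reg_ring X U\<close> is a ring, which
    makes its constants 0 and 1 regular.\<close>
  have const: "(\<lambda>x\<in>U. 1) \<in> reg X U" "(\<lambda>x\<in>U. 0) \<in> reg X U" if "U \<in> Opens X" for U
  proof -
    have "ring (reg_ring X U)"
      using module[OF that] by (simp add: Module.module_def cring_def)
    then show "(\<lambda>x\<in>U. 1) \<in> reg X U" "(\<lambda>x\<in>U. 0) \<in> reg X U"
      using ring.ring_simprules(2,6)[of "reg_ring X U"] by (simp_all add: reg_ring_def)
  qed
  have top: "points X \<in> Opens X"
    by (simp add: points_def Opens_def)
  have "(\<lambda>x\<in>points X. 1) \<in> sects (OX X) (points X)"
    using const(1)[OF top] by (simp add: OX_def mk_module_def)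
  \<comment> \<open>Local surjectivity of \<open>\<beta>\<close> lifts the constant section 1 near
    \<open>x\<close>.\<close>
  then obtain W v where W: "W \<in> Opens X" "x \<in> W" "W \<subseteq> points X" and v: "v \<in> sects V W"
    and \<beta>v: "\<beta> W v = res (OX X) (points X) W (\<lambda>x\<in>points X. 1)"
    using exact top x unfolding short_exact_def by blast
  have zero: "\<zero>\<^bsub>sec V W\<^esub> \<in> sects V W"
    using module[OF W(1)] by (simp add: Module.module_def abelian_group_def abelian_monoid.zero_closed)
  have WW: "W \<in> Opens (restr X W)"
    using W(1) by (simp add: Opens_def restr_def openin_subtopology_refl openin_subset)
  \<comment> \<open>The constant 1 gives \<open>\<beta>\<close> over \<open>W\<close>, the constant
    0 the zero functional. Both are extensional, so evaluating them needs \<open>WW\<close> and the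
    membership facts \<open>v\<close> and \<open>zero\<close>.\<close>
  define scaled where
    "scaled c = (\<lambda>W'\<in>Opens (restr X W). \<lambda>v\<in>sects V W'. \<lambda>x\<in>W'. c x * \<beta> W' v x)" for c
  have scaled: "scaled c \<in> dual_image X V \<beta> W" if "c \<in> reg X W" for c
    using that by (auto simp: dual_image_def scaled_def)
  show thesis
  proof
    show "W \<in> Opens X" "x \<in> W" by fact+
    show "(\<zero>\<^bsub>sec V W\<^esub>, scaled (\<lambda>x\<in>W. 1)) \<in> (displayed_filtration X V \<beta> ! 0) W"
      using scaled const W by (simp add: displayed_filtration_def)
    show "(v, scaled (\<lambda>x\<in>W. 0)) \<in> (displayed_filtration X V \<beta> ! 1) W"
      using scaled const W v by (simp add: displayed_filtration_def)
    show "duality_form W (\<zero>\<^bsub>sec V W\<^esub>, scaled (\<lambda>x\<in>W. 1)) (v, scaled (\<lambda>x\<in>W. 0)) x = 1"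
      using W(2,3) WW v zero \<beta>v by (auto simp: duality_form_def scaled_def OX_def)
  qed
qed

theorem lemma5p2:
  fixes X :: "('n::finite) pspace fspace"
    and L :: "('n pspace, 'l) presheaf"
    and V :: "('n pspace, 'v) presheaf"
    and \<alpha> :: "'n pspace set \<Rightarrow> ('n pspace set \<Rightarrow> ('n pspace \<Rightarrow> complex) \<Rightarrow> 'n pspace \<Rightarrow> complex) \<Rightarrow> 'v"
    and \<beta> :: "'n pspace set \<Rightarrow> 'v \<Rightarrow> 'n pspace \<Rightarrow> complex"
  assumes "K3_surface X"
    and "polarization X L"
    and "sheaf_of_modules X V"
    and "short_exact X (tangent_sheaf X) V (OX X) \<alpha> \<beta>"
    and "\<not> split_surj X V (OX X) \<beta>"
  shows "\<not> corresponds_to_parabolic_reduction X (sum_sheaf V (dual X V)) duality_form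
             (displayed_filtration X V \<beta>) \<and>
         (\<forall>Fs. gieseker_HN_filtration X L (sum_sheaf V (dual X V)) Fs \<and>
               same_filtration X Fs (displayed_filtration X V \<beta>) \<longrightarrow>
            \<not> corresponds_to_parabolic_reduction X (sum_sheaf V (dual X V)) duality_form Fs)"
proof -
  let ?F = "sum_sheaf V (dual X V)" and ?D = "displayed_filtration X V \<beta>"
  have not_red: "\<not> corresponds_to_parabolic_reduction X ?F duality_form ?D"
  proof
    assume red: "corresponds_to_parabolic_reduction X ?F duality_form ?D"
    then have red': "corresponds_to_parabolic_reduction X ?F duality_form [?D ! 0, ?D ! 1, ?D ! 2]"
      by (simp add: displayed_filtration_def)
    have full: "(?D ! 2) W = sects ?F W" for W
      by (simp add: displayed_filtration_def sum_sheaf_def mk_module_def)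
    obtain U where U: "big_open X U" and orth: "\<And>x W s t. x \<in> U \<Longrightarrow> W \<in> Opens X \<Longrightarrow> x \<in> W \<Longrightarrow>
        s \<in> (?D ! 0) W \<Longrightarrow> t \<in> (?D ! 1) W \<Longrightarrow> duality_form W s t x = 0"
      using parabolic_reduction_first_two_steps_orthogonal[OF red' full] by metis
    \<comment> \<open>At such a point the pairing of the first two steps always vanishes, yet one
      pair of local sections gives 1.\<close>
    obtain x where x: "x \<in> U"
      using big_open_nonempty[OF U K3_surface_irreducible[OF assms(1)]] by blast
    then have "x \<in> points X"
      using U by (auto simp: big_open_def Opens_def points_def dest: openin_subset)
    then show False
      using displayed_filtration_steps_not_orthogonal[OF assms(3,4)] orth x by (metis zero_neq_one)
  qed
  then show ?thesis
    using corresponds_to_parabolic_reduction_cong by blast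
qed

end
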